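(* Let $\Omega\subset\mathbb{R}^n$ be a convex domain, let $\phi(\varepsilon)$, $\varepsilon>0$, be a positive function with $\lim_{\varepsilon\to0}\phi(\varepsilon)=\infty$ and $\lim_{\varepsilon\to0}\varepsilon\,\phi(\varepsilon)=0$, and let $f\in C(\Omega)$ be non-negative. Let $u\in C(\Omega)$ be convex. (i) $u$ is a viscosity subsolution of $\det D^2u=f$ in $\Omega$ if and only if for every $x\in\Omega$ and every convex paraboloid $P$ that touches $u$ from above at $x$, $$P(x)\le\inf_{\substack{\det A=1\\ A\le\phi(\varepsilon)I}}\left\{\frac{1}{|B_\varepsilon(0)|}\int_{B_\varepsilon(0)}P(x+Ay)\,dy\right\}-\frac{n}{2(n+2)}\,(f(x))^{1/n}\,\varepsilon^2+o(\varepsilon^2)\qquad\text{as }\varepsilon\to0.$$ (ii) $u$ is a viscosity supersolution of $\det D^2u=f$ in $\Omega$ if and only if for every $x\in\Omega$ and every convex paraboloid $P$ that touches $u$ from below at $x$, $$P(x)\ge\inf_{\substack{\det A=1\\ A\le\phi(\varepsilon)I}}\left\{\frac{1}{|B_\varepsilon(0)|}\int_{B_\varepsilon(0)}P(x+Ay)\,dy\right\}-\frac{n}{2(n+2)}\,(f(x))^{1/n}\,\varepsilon^2+o(\varepsilon^2)\qquad\text{as }\varepsilon\to0.$$ The infima are over symmetric positive definite $n\times n$ real matrices $A$ satisfying the stated constraints.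
   Context: $B_\varepsilon(0)=\{y\in\mathbb{R}^n:|y|\le\varepsilon\}$. For symmetric matrices, $A\le\phi(\varepsilon)I$ means $\phi(\varepsilon)I-A$ is positive semidefinite. A paraboloid is a polynomial $P:\mathbb{R}^n\to\mathbb{R}$ of degree at most two, i.e. a $C^2$ function coinciding with its second-order Taylor expansion at any point; it is convex iff $D^2P\ge0$. $P$ touches $u$ from above (resp. below) at $x\in\Omega$ if $P(x)=u(x)$ and $P\ge u$ (resp. $P\le u$) in a neighborhood of $x$. A convex function $u$ is a viscosity subsolution (resp. supersolution) of $\det D^2u=f$ in $\Omega$ if for every $x_0\in\Omega$ and every convex paraboloid $P$ touching $u$ from above (resp. below) at $x_0$ one has $\det D^2P(x_0)\ge f(x_0)$ (resp. $\det D^2P(x_0)\le f(x_0)$). For a constant $c$ and a real function $g$: "$c\le g(\varepsilon)+o(\varepsilon^2)$ as $\varepsilon\to0$" means $\lim_{\varepsilon\to0}[c-g(\varepsilon)]^+/\varepsilon^2=0$, and "$c\ge g(\varepsilon)+o(\varepsilon^2)$ as $\varepsilon\to0$" means $\lim_{\varepsilon\to0}[c-g(\varepsilon)]^-/\varepsilon^2=0$, where $[\cdot]^\pm$ denote positive and negative parts. *)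

theory Defs
  imports "HOL-Analysis.Analysis"
begin

definition pos_semidef :: "real^'n^'n \<Rightarrow> bool" where
  "pos_semidef A \<longleftrightarrow> transpose A = A \<and> (\<forall>v. 0 \<le> v \<bullet> (A *v v))"

definition pos_def :: "real^'n^'n \<Rightarrow> bool" where
  "pos_def A \<longleftrightarrow> transpose A = A \<and> (\<forall>v. v \<noteq> 0 \<longrightarrow> 0 < v \<bullet> (A *v v))"

definition partial_deriv :: "'n \<Rightarrow> (real^'n \<Rightarrow> real) \<Rightarrow> real^'n \<Rightarrow> real" where
  "partial_deriv i g x = frechet_derivative g (at x) (axis i 1)"

definition hessian :: "(real^'n \<Rightarrow> real) \<Rightarrow> real^'n \<Rightarrow> real^'n^'n" where
  "hessian g x = (\<chi> i j. partial_deriv i (partial_deriv j g) x)"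

text \<open>Polynomials of degree at most two. The matrix \<open>M\<close> of the quadratic part need not be
  symmetric, so \<open>hessian P x\<close> is \<open>M + transpose M\<close>.\<close>

definition paraboloid :: "(real^'n \<Rightarrow> real) \<Rightarrow> bool" where
  "paraboloid P \<longleftrightarrow> (\<exists>c b M. \<forall>y. P y = c + b \<bullet> y + y \<bullet> (M *v y))"

definition convex_paraboloid :: "(real^'n \<Rightarrow> real) \<Rightarrow> bool" where
  "convex_paraboloid P \<longleftrightarrow> paraboloid P \<and> convex_on UNIV P"

text \<open>A function on an open set \<open>\<Omega>\<close> is represented by a total function. Touching is only used at
  points of \<open>\<Omega>\<close>, where it does not depend on the values outside \<open>\<Omega>\<close>, because \<open>\<Omega>\<close> is open.\<close>

definition touches_above :: "(real^'n \<Rightarrow> real) \<Rightarrow> (real^'n \<Rightarrow> real) \<Rightarrow> real^'n \<Rightarrow> bool" where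
  "touches_above P u x \<longleftrightarrow> P x = u x \<and> (\<forall>\<^sub>F y in nhds x. u y \<le> P y)"

definition touches_below :: "(real^'n \<Rightarrow> real) \<Rightarrow> (real^'n \<Rightarrow> real) \<Rightarrow> real^'n \<Rightarrow> bool" where
  "touches_below P u x \<longleftrightarrow> P x = u x \<and> (\<forall>\<^sub>F y in nhds x. P y \<le> u y)"

definition viscosity_subsolution ::
    "(real^'n) set \<Rightarrow> (real^'n \<Rightarrow> real) \<Rightarrow> (real^'n \<Rightarrow> real) \<Rightarrow> bool" where
  "viscosity_subsolution \<Omega> f u \<longleftrightarrow> convex_on \<Omega> u \<and>
     (\<forall>x\<in>\<Omega>. \<forall>P. convex_paraboloid P \<and> touches_above P u x \<longrightarrow> det (hessian P x) \<ge> f x)"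

definition viscosity_supersolution ::
    "(real^'n) set \<Rightarrow> (real^'n \<Rightarrow> real) \<Rightarrow> (real^'n \<Rightarrow> real) \<Rightarrow> bool" where
  "viscosity_supersolution \<Omega> f u \<longleftrightarrow> convex_on \<Omega> u \<and>
     (\<forall>x\<in>\<Omega>. \<forall>P. convex_paraboloid P \<and> touches_below P u x \<longrightarrow> det (hessian P x) \<le> f x)"

text \<open>Here \<open>mat t\<close> is the scalar matrix \<open>t I\<close>, so the last conjunct says \<open>A \<le> t I\<close>.\<close>

definition admissible :: "real \<Rightarrow> (real^'n^'n) set" where
  "admissible t = {A. pos_def A \<and> det A = 1 \<and> pos_semidef (mat t - A)}"

definition ball_average :: "(real^'n \<Rightarrow> real) \<Rightarrow> real^'n \<Rightarrow> real^'n^'n \<Rightarrow> real \<Rightarrow> real" where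
  "ball_average P x A \<epsilon> =
     (1 / measure lborel (cball (0 :: real^'n) \<epsilon>)) * (LINT y:cball 0 \<epsilon>|lborel. P (x + A *v y))"

text \<open>The infimum is that of the real numbers, which is unspecified for the empty set. That case
  does not matter below: if \<open>\<phi> \<epsilon> \<ge> 1\<close>, the identity matrix is admissible, and for convex \<open>P\<close>
  all averages are bounded below by \<open>P x\<close>.\<close>

definition mean_value :: "(real \<Rightarrow> real) \<Rightarrow> (real^'n \<Rightarrow> real) \<Rightarrow> (real^'n \<Rightarrow> real) \<Rightarrow> real^'n \<Rightarrow> real \<Rightarrow> real" where
  "mean_value \<phi> f P x \<epsilon> =
     (INF A\<in>admissible (\<phi> \<epsilon>). ball_average P x A \<epsilon>)
       - real CARD('n) / (2 * (real CARD('n) + 2)) * root CARD('n) (f x) * \<epsilon>\<^sup>2"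

text \<open>\<open>c \<le> g \<epsilon> + o(\<epsilon>\<^sup>2)\<close> and \<open>c \<ge> g \<epsilon> + o(\<epsilon>\<^sup>2)\<close> as \<open>\<epsilon>\<close> tends to \<open>0\<close> from the right. The numerators
  are the positive and the negative part of \<open>c - g \<epsilon>\<close>.\<close>

definition le_upto_small_o_sq :: "real \<Rightarrow> (real \<Rightarrow> real) \<Rightarrow> bool" where
  "le_upto_small_o_sq c g \<longleftrightarrow> ((\<lambda>\<epsilon>. max (c - g \<epsilon>) 0 / \<epsilon>\<^sup>2) \<longlongrightarrow> 0) (at_right 0)"

definition ge_upto_small_o_sq :: "real \<Rightarrow> (real \<Rightarrow> real) \<Rightarrow> bool" where
  "ge_upto_small_o_sq c g \<longleftrightarrow> ((\<lambda>\<epsilon>. max (- (c - g \<epsilon>)) 0 / \<epsilon>\<^sup>2) \<longlongrightarrow> 0) (at_right 0)"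

end

theory Submission
  imports Defs
begin

text \<open>The equivalence holds separately for every convex paraboloid \<open>P\<close> and every point \<open>x\<close>. With
  \<open>H = hessian P x\<close>, the second moments of the ball give
  \[ \frac{1}{|B_\varepsilon|} \int_{B_\varepsilon} P(x + A y)\,dy
     = P(x) + \frac{\varepsilon^2}{2(n+2)} \mathrm{tr}(A H A). \]
  If \<open>det A = 1\<close>, then \<open>det (A H A) = det H\<close>, and the arithmetic-geometric mean inequality for the
  eigenvalues of \<open>A H A\<close> bounds the trace from below by \<open>n\<close> times the \<open>n\<close>-th root of \<open>det H\<close>. This
  bound is the infimum over all such \<open>A\<close>. As \<open>\<phi> \<epsilon>\<close> tends to infinity, every fixed competitor
  becomes admissible, so the quotient of \<open>P x - mean_value \<phi> f P x \<epsilon>\<close> by \<open>\<epsilon>\<^sup>2\<close> converges to a positive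
  multiple of the difference of the \<open>n\<close>-th roots of \<open>f x\<close> and \<open>det H\<close>, whose sign decides both
  conditions.\<close>

section \<open>Diagonalization of real symmetric matrices\<close>

lemma symmetric_inner_matrix_vector:
  fixes A :: "real^'n^'n"
  assumes "transpose A = A"
  shows "x \<bullet> (A *v y) = (A *v x) \<bullet> y"
  using dot_lmul_matrix[of x A y] assms by (metis transpose_matrix_vector)

text \<open>First variation of the Rayleigh quotient at \<open>v\<close> in the direction \<open>g = A v - l v\<close>.\<close>

lemma symmetric_maximizer_is_eigenvector:
  fixes A :: "real^'n^'n"
  assumes sym: "transpose A = A" and S: "subspace S" and inv: "\<And>x. x \<in> S \<Longrightarrow> A *v x \<in> S"
    and v: "v \<in> S" "norm v = 1"
    and max: "\<And>x. x \<in> S \<Longrightarrow> x \<bullet> (A *v x) \<le> l * (x \<bullet> x)" and l: "l = v \<bullet> (A *v v)"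
  shows "A *v v = l *\<^sub>R v"
proof -
  define g where "g = A *v v - l *\<^sub>R v"
  have vv: "v \<bullet> v = 1" using v(2) by (simp add: norm_eq_1)
  have gS: "g \<in> S" unfolding g_def using S inv v(1) by (simp add: subspace_diff subspace_scale)
  have gv: "g \<bullet> v = 0" unfolding g_def inner_diff_left inner_scaleR_left vv l by (simp add: inner_commute)
  then have gg: "g \<bullet> (A *v v) = g \<bullet> g" unfolding g_def by (simp add: inner_diff_right)
  have vg: "v \<bullet> (A *v g) = g \<bullet> g"
    using symmetric_inner_matrix_vector[OF sym, of v g] gg by (simp add: inner_commute)
  define C where "C = l * (g \<bullet> g) - g \<bullet> (A *v g)"
  \<comment> \<open>As \<open>g\<close> is orthogonal to \<open>v\<close>, \<open>max\<close> at
    \<open>v + t g\<close> reads \<open>l + 2 t |g|^2 + t^2 g \<bullet> (A g) \<le> l (1 + t^2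
    |g|^2)\<close>. Cancel \<open>l\<close> and divide by \<open>t\<close>; letting \<open>t\<close>
    tend to \<open>0\<close> then forces \<open>g = 0\<close>.\<close>
  have ineq: "2 * (g \<bullet> g) \<le> t * C" if "t > 0" for t
  proof -
    have "v + t *\<^sub>R g \<in> S" using S v(1) gS by (simp add: subspace_add subspace_scale)
    from max[OF this] have "t * (2 * (g \<bullet> g)) \<le> t * (t * C)"
      using gv gg vg vv
      by (simp add: C_def matrix_vector_right_distrib matrix_vector_mult_scaleR inner_add_left inner_add_right
          inner_commute algebra_simps flip: l)
    then show ?thesis using that by simp
  qed
  have "((\<lambda>t. t * C) \<longlongrightarrow> 0 * C) (at_right 0)" by (intro tendsto_intros)
  then have "2 * (g \<bullet> g) \<le> 0 * C"
    by (rule tendsto_lowerbound) (auto simp: eventually_at_right_field intro!: exI[of _ 1] ineq)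
  then have "g \<bullet> g = 0" using inner_ge_zero[of g] by linarith
  then have "g = 0" by (simp only: inner_eq_zero_iff)
  then show ?thesis by (simp add: g_def)
qed

text \<open>The quadratic form attains its maximum on the unit sphere of \<open>S\<close>, which is
  compact, and nonempty because of \<open>w\<close>. Homogeneity extends the bound to all of
  \<open>S\<close>, so the maximizer is an eigenvector by the first variation.\<close>

lemma symmetric_eigenvector_in_invariant_subspace:
  fixes A :: "real^'n^'n"
  assumes sym: "transpose A = A" and S: "subspace S" and inv: "\<And>x. x \<in> S \<Longrightarrow> A *v x \<in> S"
    and w: "w \<in> S" "w \<noteq> 0"
  obtains v l where "v \<in> S" "norm v = 1" "A *v v = l *\<^sub>R v"
proof -
  have "compact (sphere 0 1 \<inter> S)"
    using closed_subspace[OF S] by (intro compact_Int_closed) auto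
  moreover have "w /\<^sub>R norm w \<in> sphere 0 1 \<inter> S" using w S by (simp add: subspace_scale)
  moreover have "continuous_on (sphere 0 1 \<inter> S) (\<lambda>x. x \<bullet> (A *v x))"
    by (intro continuous_intros matrix_vector_mult_linear_continuous_on)
  ultimately obtain v where v: "v \<in> sphere 0 1 \<inter> S"
    and vmax: "\<And>x. x \<in> sphere 0 1 \<inter> S \<Longrightarrow> x \<bullet> (A *v x) \<le> v \<bullet> (A *v v)"
    using continuous_attains_sup[of "sphere 0 1 \<inter> S" "\<lambda>x. x \<bullet> (A *v x)"] by blast
  define l where "l = v \<bullet> (A *v v)"
  have "x \<bullet> (A *v x) \<le> l * (x \<bullet> x)" if "x \<in> S" for x
  proof (cases "x = 0")
    case False
    have "x /\<^sub>R norm x \<in> sphere 0 1 \<inter> S" using False that S by (simp add: subspace_scale)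
    from vmax[OF this] have "(x \<bullet> (A *v x)) / (norm x * norm x) \<le> l"
      by (simp add: l_def matrix_vector_mult_scaleR divide_inverse mult_ac)
    then show ?thesis using False by (simp add: field_simps dot_square_norm power2_eq_square)
  qed auto
  then have "A *v v = l *\<^sub>R v"
    using symmetric_maximizer_is_eigenvector[OF sym S inv] v l_def by auto
  with v that show ?thesis by auto
qed

text \<open>Induction on \<open>k\<close>: symmetry makes the orthogonal complement \<open>S\<close>
  of the eigenvectors found so far invariant, and a dimension count makes it nontrivial, so it
  contains a further unit eigenvector.\<close>

lemma symmetric_orthonormal_eigenvectors:
  fixes A :: "real^'n^'n"
  assumes sym: "transpose A = A" and "k \<le> CARD('n)"
  shows "\<exists>B. finite B \<and> card B = k \<and> pairwise orthogonal B \<and> (\<forall>b\<in>B. norm b = 1 \<and> (\<exists>l. A *v b = l *\<^sub>R b))"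
  using assms(2)
proof (induction k)
  case 0
  show ?case by (intro exI[of _ "{}"]) auto
next
  case (Suc k)
  then obtain B where B: "finite B" "card B = k" "pairwise orthogonal B"
    "\<And>b. b \<in> B \<Longrightarrow> norm b = 1" "\<And>b. b \<in> B \<Longrightarrow> \<exists>l. A *v b = l *\<^sub>R b" by auto
  have "dim B \<le> k" using dim_le_card[OF span_superset B(1)] B(2) by simp
  then have "dim B < DIM(real^'n)" using Suc.prems by simp
  then obtain w where w: "w \<noteq> 0" "\<And>y. y \<in> span B \<Longrightarrow> orthogonal w y"
    using orthogonal_to_subspace_exists[of B] by metis
  define S where "S = {x. \<forall>b\<in>B. b \<bullet> x = 0}"
  have S: "subspace S" unfolding S_def subspace_def by (simp add: inner_add_right)
  have inv: "A *v x \<in> S" if "x \<in> S" for x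
  proof -
    have "b \<bullet> (A *v x) = 0" if b: "b \<in> B" for b
    proof -
      obtain l where "A *v b = l *\<^sub>R b" using B(5)[OF b] ..
      with symmetric_inner_matrix_vector[OF sym, of b x] \<open>x \<in> S\<close> b show ?thesis
        by (simp add: S_def)
    qed
    then show ?thesis by (simp add: S_def)
  qed
  have "w \<in> S" using w(2) by (auto simp: S_def span_base orthogonal_def inner_commute)
  then obtain v l where v: "v \<in> S" "norm v = 1" "A *v v = l *\<^sub>R v"
    using symmetric_eigenvector_in_invariant_subspace[OF sym S inv _ w(1)] by metis
  have "v \<notin> B" using v by (auto simp: S_def)
  moreover have "pairwise orthogonal (insert v B)"
    using B(3) v(1) by (auto simp: pairwise_insert S_def orthogonal_def inner_commute)
  ultimately show ?case using B v by (intro exI[of _ "insert v B"]) auto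
qed

section \<open>Diagonal matrices, the spectral theorem and orthogonal conjugation\<close>

definition diag_matrix :: "('n \<Rightarrow> real) \<Rightarrow> real^'n^'n" where
  "diag_matrix d = (\<chi> i j. if i = j then d i else 0)"

lemma diag_matrix_vector: "diag_matrix d *v x = (\<chi> i. d i * x $ i)"
  by (simp add: diag_matrix_def matrix_vector_mult_def vec_eq_iff if_distrib[of "\<lambda>a. a * _"] cong: if_cong)

lemma diag_matrix_mult: "diag_matrix d ** diag_matrix e = diag_matrix (\<lambda>i. d i * e i)"
  by (simp add: diag_matrix_def matrix_matrix_mult_def vec_eq_iff if_distrib[of "\<lambda>a. a * _"] cong: if_cong)

lemma transpose_diag_matrix: "transpose (diag_matrix d) = diag_matrix d"
  by (auto simp: diag_matrix_def transpose_def vec_eq_iff)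

lemma trace_diag_matrix: "trace (diag_matrix d) = (\<Sum>i\<in>UNIV. d i)"
  by (simp add: diag_matrix_def trace_def)

lemma det_diag_matrix: "det (diag_matrix d) = (\<Prod>i\<in>UNIV. d i)"
  by (subst det_diagonal) (auto simp: diag_matrix_def)

text \<open>The columns of \<open>Q\<close> are an orthonormal eigenbasis indexed by
  \<open>'n\<close>. Columnwise, \<open>A ** Q = Q ** diag_matrix d\<close> is the eigenvector
  equation; multiplying by \<open>transpose Q\<close> on the right isolates
  \<open>A\<close>.\<close>

theorem symmetric_matrix_diagonalization:
  fixes A :: "real^'n^'n"
  assumes sym: "transpose A = A"
  obtains Q d where "orthogonal_matrix Q" "A = Q ** diag_matrix d ** transpose Q"
proof -
  obtain B where B: "finite B" "card B = CARD('n)" "pairwise orthogonal B"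
    "\<And>b. b \<in> B \<Longrightarrow> norm b = 1" "\<And>b. b \<in> B \<Longrightarrow> \<exists>l. A *v b = l *\<^sub>R b"
    using symmetric_orthonormal_eigenvectors[OF sym order_refl] by blast
  obtain q :: "'n \<Rightarrow> real^'n" where q: "bij_betw q UNIV B"
    using finite_same_card_bij[of "UNIV :: 'n set" B] B by auto
  then have qB: "q i \<in> B" for i by (auto simp: bij_betw_def)
  obtain d where d: "\<And>i. A *v q i = d i *\<^sub>R q i" using B(5)[OF qB] by metis
  define Q :: "real^'n^'n" where "Q = (\<chi> i j. q j $ i)"
  have col: "column j Q = q j" for j by (simp add: column_def Q_def vec_eq_iff)
  have "orthogonal_matrix Q"
    unfolding orthogonal_matrix_orthonormal_columns col
    using B(3,4) qB q by (auto simp: pairwise_def bij_betw_def inj_eq)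
  moreover have "A ** Q = Q ** diag_matrix d"
  proof -
    have "(A ** Q) $ i $ j = (Q ** diag_matrix d) $ i $ j" for i j
    proof -
      have "(A ** Q) $ i $ j = (A *v q j) $ i"
        by (simp add: matrix_matrix_mult_def matrix_vector_mult_def Q_def)
      also have "\<dots> = (Q ** diag_matrix d) $ i $ j"
        by (simp add: d matrix_matrix_mult_def diag_matrix_def Q_def if_distrib[of "\<lambda>a. _ * a"] mult.commute cong: if_cong)
      finally show ?thesis .
    qed
    then show ?thesis by (simp add: vec_eq_iff)
  qed
  then have "A ** (Q ** transpose Q) = Q ** diag_matrix d ** transpose Q"
    by (simp add: matrix_mul_assoc)
  ultimately show ?thesis using that by (simp add: orthogonal_matrix_def)
qed

lemma
  fixes Q :: "real^'n^'n"
  assumes "orthogonal_matrix Q"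
  shows trace_orthogonal_conjugate: "trace (Q ** D ** transpose Q) = trace D"
    and det_orthogonal_conjugate: "det (Q ** D ** transpose Q) = det D"
proof -
  show "trace (Q ** D ** transpose Q) = trace D"
    using assms by (metis matrix_mul_assoc matrix_mul_lid orthogonal_matrix trace_mul_sym)
  show "det (Q ** D ** transpose Q) = det D"
    using det_orthogonal_matrix[OF assms] by (auto simp: det_mul)
qed

lemma transpose_orthogonal_conjugate_diag:
  "transpose (Q ** diag_matrix d ** transpose Q) = Q ** diag_matrix d ** transpose Q"
  by (simp add: matrix_transpose_mul transpose_diag_matrix matrix_mul_assoc)

lemma orthogonal_conjugate_mult:
  fixes Q :: "real^'n^'n"
  assumes "orthogonal_matrix Q"
  shows "(Q ** D ** transpose Q) ** (Q ** E ** transpose Q) = Q ** (D ** E) ** transpose Q"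
  using assms by (metis matrix_mul_assoc matrix_mul_lid orthogonal_matrix)

lemma quadratic_form_orthogonal_conjugate_diag:
  "v \<bullet> ((Q ** diag_matrix d ** transpose Q) *v v) = (\<Sum>i\<in>UNIV. d i * ((transpose Q *v v) $ i)\<^sup>2)"
proof -
  have "v \<bullet> ((Q ** diag_matrix d ** transpose Q) *v v) = v \<bullet> (Q *v (diag_matrix d *v (transpose Q *v v)))"
    by (simp only: matrix_vector_mul_assoc matrix_mul_assoc)
  also have "\<dots> = (transpose Q *v v) \<bullet> (diag_matrix d *v (transpose Q *v v))"
    by (metis dot_lmul_matrix transpose_matrix_vector)
  finally show ?thesis
    by (simp add: diag_matrix_vector inner_vec_def power2_eq_square algebra_simps)
qed

section \<open>Traces of congruent matrices\<close>

lemma pos_semidef_diagonalization: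
  fixes H :: "real^'n^'n"
  assumes "pos_semidef H"
  obtains Q d where "orthogonal_matrix Q" "H = Q ** diag_matrix d ** transpose Q" "\<And>i. d i \<ge> 0"
proof -
  obtain Q d where Q: "orthogonal_matrix Q" and H: "H = Q ** diag_matrix d ** transpose Q"
    using symmetric_matrix_diagonalization assms by (metis pos_semidef_def)
  have "d i \<ge> 0" for i
  proof -
    \<comment> \<open>The test vector \<open>Q *v axis i 1\<close> is the unit eigenvector for
      \<open>d i\<close>, so the form takes the value \<open>d i\<close> there.\<close>
    have "transpose Q *v (Q *v axis i 1) = axis i 1"
      using Q by (simp add: matrix_vector_mul_assoc orthogonal_matrix)
    then have "(Q *v axis i 1) \<bullet> (H *v (Q *v axis i 1)) = d i"
      unfolding H quadratic_form_orthogonal_conjugate_diag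
      by (simp add: axis_def if_distrib[of "\<lambda>a. a ^ _"] if_distrib[of "\<lambda>a. _ * a"] cong: if_cong)
    then show ?thesis using assms by (metis pos_semidef_def)
  qed
  with Q H that show ?thesis by blast
qed

lemma pos_semidef_trace_ge_root_det:
  fixes H :: "real^'n^'n"
  assumes "pos_semidef H"
  shows "real CARD('n) * root CARD('n) (det H) \<le> trace H"
proof -
  obtain Q d where Q: "orthogonal_matrix Q" and H: "H = Q ** diag_matrix d ** transpose Q"
    and d: "\<And>i. d i \<ge> 0" using pos_semidef_diagonalization[OF assms] by blast
  have det: "det H = (\<Prod>i\<in>UNIV. d i)" and tr: "trace H = (\<Sum>i\<in>UNIV. d i)"
    by (simp_all add: H Q det_orthogonal_conjugate trace_orthogonal_conjugate det_diag_matrix trace_diag_matrix)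
  \<comment> \<open>Arithmetic-geometric mean for the eigenvalues. A vanishing product is treated
    apart because \<open>root_powr_inverse\<close> turns the root into a real power only for
    positive arguments.\<close>
  have "root CARD('n) (\<Prod>i\<in>UNIV. d i) \<le> (\<Sum>i\<in>UNIV. d i / CARD('n))"
  proof (cases "(\<Prod>i\<in>UNIV. d i) = 0")
    case True
    have "0 \<le> (\<Sum>i\<in>UNIV. d i / CARD('n))" using d by (intro sum_nonneg) simp
    then show ?thesis unfolding True by simp
  next
    case False
    then have "(\<Prod>i\<in>UNIV. d i) > 0" using d by (simp add: less_le prod_nonneg)
    then show ?thesis using arith_geom_mean[of UNIV d] d by (simp add: root_powr_inverse)
  qed
  then show "real CARD('n) * root CARD('n) (det H) \<le> trace H"
    by (simp add: det tr field_simps flip: sum_divide_distrib)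
qed

lemma pos_semidef_congruence:
  fixes A :: "real^'n^'n"
  assumes "pos_semidef H" and "transpose A = A"
  shows "pos_semidef (A ** H ** A)"
proof -
  have "v \<bullet> ((A ** H ** A) *v v) = (A *v v) \<bullet> (H *v (A *v v))" for v
    using symmetric_inner_matrix_vector[OF assms(2)]
    by (simp flip: matrix_vector_mul_assoc matrix_mul_assoc)
  then show ?thesis using assms
    by (simp add: pos_semidef_def matrix_transpose_mul matrix_mul_assoc)
qed

lemma admissible_trace_lower_bound:
  fixes H :: "real^'n^'n"
  assumes "pos_semidef H" and "A \<in> admissible t"
  shows "real CARD('n) * root CARD('n) (det H) \<le> trace (A ** H ** A)"
  using pos_semidef_trace_ge_root_det[OF pos_semidef_congruence[OF assms(1), of A]] assms(2)
  by (simp add: admissible_def pos_def_def det_mul)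

text \<open>By Cauchy-Schwarz every \<open>t\<close> above the operator norm of \<open>A\<close>
  will do. This lets a competitor chosen independently of \<open>\<epsilon>\<close> be used for all
  small \<open>\<epsilon>\<close>.\<close>

lemma eventually_admissible:
  assumes "pos_def A" and "det A = 1"
  shows "\<forall>\<^sub>F t in at_top. A \<in> admissible t"
proof -
  have "A \<in> admissible t" if t: "t \<ge> onorm ((*v) A)" for t
  proof -
    have "v \<bullet> (A *v v) \<le> t * (v \<bullet> v)" for v
    proof -
      have "v \<bullet> (A *v v) \<le> norm v * (onorm ((*v) A) * norm v)"
        using norm_cauchy_schwarz[of v "A *v v"] onorm[of "(*v) A" v]
        by (meson dual_order.trans matrix_vector_mul_bounded_linear mult_left_mono norm_ge_zero)
      also have "\<dots> \<le> norm v * (t * norm v)" using t by (intro mult_left_mono mult_right_mono) auto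
      finally show ?thesis by (simp add: dot_square_norm power2_eq_square mult_ac)
    qed
    moreover have "transpose (mat t - A) = mat t - A"
      using assms by (auto simp: pos_def_def transpose_def mat_def vec_eq_iff)
    moreover have "mat t *v v = t *\<^sub>R v" for v :: "real^'a"
      by (simp add: mat_def matrix_vector_mult_def vec_eq_iff if_distrib[of "\<lambda>a. a * _"] cong: if_cong)
    ultimately show ?thesis using assms
      by (simp add: admissible_def pos_semidef_def matrix_vector_mult_diff_rdistrib inner_diff_right)
  qed
  then show ?thesis using eventually_ge_at_top by (rule eventually_mono[rotated])
qed

text \<open>The infimum is attained at a multiple of \<open>H\<close> to the power \<open>- 1 / 2\<close>; a singular \<open>H\<close> is
  perturbed to \<open>H + \<eta> I\<close>.\<close>

lemma admissible_trace_upper_bound: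
  fixes H :: "real^'n^'n"
  assumes "pos_semidef H" and "\<delta> > 0"
  obtains A :: "real^'n^'n" where "pos_def A" "det A = 1"
    "trace (A ** H ** A) < real CARD('n) * root CARD('n) (det H) + \<delta>"
proof -
  obtain Q d where Q: "orthogonal_matrix Q" and H: "H = Q ** diag_matrix d ** transpose Q"
    and d: "\<And>i. d i \<ge> 0" using pos_semidef_diagonalization[OF assms(1)] by blast
  \<comment> \<open>\<open>c \<eta>\<close> is the root of the determinant of
    \<open>H + \<eta> I\<close>. By continuity at \<open>0\<close>, some \<open>\<eta> > 0\<close>
    raises the bound by less than \<open>\<delta>\<close>.\<close>
  define c where "c \<eta> = root CARD('n) (\<Prod>i\<in>UNIV. d i + \<eta>)" for \<eta>
  have det: "det H = (\<Prod>i\<in>UNIV. d i)"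
    by (simp add: H Q det_orthogonal_conjugate det_diag_matrix)
  have "((\<lambda>\<eta>. real CARD('n) * c \<eta>) \<longlongrightarrow> real CARD('n) * root CARD('n) (\<Prod>i\<in>UNIV. d i + 0)) (at_right 0)"
    unfolding c_def by (intro tendsto_intros)
  then have "\<forall>\<^sub>F \<eta> in at_right 0. real CARD('n) * c \<eta> < real CARD('n) * root CARD('n) (det H) + \<delta>"
    by (rule order_tendstoD) (simp add: det assms)
  then have "\<forall>\<^sub>F \<eta> in at_right 0. \<eta> > 0 \<and> real CARD('n) * c \<eta> < real CARD('n) * root CARD('n) (det H) + \<delta>"
    using eventually_at_right_less by (rule eventually_conj[rotated])
  then obtain \<eta> where \<eta>: "\<eta> > 0" "real CARD('n) * c \<eta> < real CARD('n) * root CARD('n) (det H) + \<delta>"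
    using eventually_happens'[OF trivial_limit_at_right_real] by blast
  have pos: "d i + \<eta> > 0" for i using d[of i] \<eta>(1) by simp
  then have dprod_pos: "(\<Prod>i\<in>UNIV. d i + \<eta>) > 0" by (simp add: prod_pos)
  then have c: "c \<eta> > 0" by (simp add: c_def)
  \<comment> \<open>The \<open>e i\<close> are the eigenvalues of
    \<open>A = sqrt (c \<eta>) (H + \<eta> I)^(-1/2)\<close>, so that
    \<open>A (H + \<eta> I) A = c \<eta> I\<close>; the factor \<open>c \<eta>\<close> normalizes
    the determinant to \<open>1\<close>.\<close>
  define e where "e i = sqrt (c \<eta> / (d i + \<eta>))" for i
  have e: "e i > 0" "(e i)\<^sup>2 = c \<eta> / (d i + \<eta>)" for i using pos[of i] c by (auto simp: e_def)
  define A where "A = Q ** diag_matrix e ** transpose Q"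
  have "pos_def A"
    unfolding pos_def_def
  proof (intro conjI allI impI)
    show "transpose A = A" unfolding A_def by (rule transpose_orthogonal_conjugate_diag)
    fix v :: "real^'n" assume "v \<noteq> 0"
    then have "transpose Q *v v \<noteq> 0" using Q
      by (metis matrix_vector_mul_assoc matrix_vector_mul_lid matrix_vector_mult_0_right orthogonal_matrix_def)
    then obtain i where "(transpose Q *v v) $ i \<noteq> 0" by (auto simp: vec_eq_iff)
    then show "0 < v \<bullet> (A *v v)"
      unfolding A_def quadratic_form_orthogonal_conjugate_diag
      using e(1) by (intro sum_pos2[of _ i]) (auto intro!: mult_nonneg_nonneg less_imp_le[OF e(1)])
  qed
  moreover have "det A = 1"
  proof -
    \<comment> \<open>Squaring removes the square roots; positivity of the \<open>e i\<close> then
      excludes the value \<open>- 1\<close>.\<close>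
    have "(\<Prod>i\<in>UNIV. e i)\<^sup>2 = (\<Prod>i\<in>UNIV. c \<eta> / (d i + \<eta>))" by (simp add: e(2) prod_power_distrib)
    also have "\<dots> = c \<eta> ^ CARD('n) / (\<Prod>i\<in>UNIV. d i + \<eta>)" by (simp add: prod_dividef)
    also have "\<dots> = 1" using dprod_pos by (simp add: c_def less_imp_neq[OF pos, symmetric])
    finally have "(\<Prod>i\<in>UNIV. e i) = 1"
      using prod_pos[of UNIV e] e(1) by (auto simp: power2_eq_1_iff)
    then show ?thesis by (simp add: A_def Q det_orthogonal_conjugate det_diag_matrix)
  qed
  moreover have "trace (A ** H ** A) = (\<Sum>i\<in>UNIV. (e i)\<^sup>2 * d i)"
    by (simp add: A_def H Q orthogonal_conjugate_mult trace_orthogonal_conjugate diag_matrix_mult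
        trace_diag_matrix power2_eq_square mult_ac)
  \<comment> \<open>Each summand is \<open>c \<eta>\<close> times
    \<open>d i / (d i + \<eta>)\<close>, a fraction that is at most \<open>1\<close>.\<close>
  moreover have "(\<Sum>i\<in>UNIV. (e i)\<^sup>2 * d i) \<le> (\<Sum>i\<in>(UNIV::'n set). c \<eta>)"
    unfolding e(2) using c pos \<eta>(1) by (intro sum_mono) (simp add: field_simps)
  ultimately show ?thesis using that \<eta>(2) by force
qed

section \<open>Second moments of the ball\<close>

lemma box_vec_eq: "box l u = {x::real^'n. \<forall>i. l $ i < x $ i \<and> x $ i < u $ i}"
  by (auto simp: mem_box Basis_vec_def inner_axis)

lemma emeasure_lborel_box_vec:
  fixes l u :: "real^'n"
  assumes "\<And>i. l $ i \<le> u $ i"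
  shows "emeasure lborel (box l u) = ennreal (\<Prod>i\<in>UNIV. u $ i - l $ i)"
proof -
  have "(\<Prod>b\<in>Basis. (u - l) \<bullet> b) = (\<Prod>i\<in>UNIV. u $ i - l $ i)"
  proof -
    have "bij_betw (\<lambda>i. axis i (1::real)) (UNIV::'n set) Basis"
      by (auto simp: bij_betw_def inj_on_def axis_eq_axis Basis_vec_def)
    from prod.reindex_bij_betw[OF this, of "\<lambda>b. (u - l) \<bullet> b"] show ?thesis
      by (simp add: inner_axis)
  qed
  then show ?thesis
    by (subst emeasure_lborel_box) (use assms in \<open>auto simp: Basis_vec_def inner_axis\<close>)
qed

text \<open>For bijective \<open>p\<close> and signs \<open>s\<close> these are linear isometries.
  They determine the second moments of the ball up to one constant: sign changes kill the mixed
  moments, transpositions equate the diagonal ones.\<close>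

definition signed_permutation :: "('n \<Rightarrow> real) \<Rightarrow> ('n \<Rightarrow> 'n) \<Rightarrow> real^'n \<Rightarrow> real^'n" where
  "signed_permutation s p x = (\<chi> k. s k * x $ p k)"

lemma norm_signed_permutation:
  assumes "bij p" and "\<And>k. \<bar>s k\<bar> = 1"
  shows "norm (signed_permutation s p x) = norm x"
proof -
  have "(s k * x $ p k)\<^sup>2 = (x $ p k)\<^sup>2" for k
    using assms(2)[of k] by (metis mult_1 power2_abs power_mult_distrib power_one)
  then show ?thesis
    using sum.reindex_bij_betw[of p UNIV UNIV "\<lambda>k. (x $ k)\<^sup>2"] assms(1)
    by (simp add: norm_vec_def L2_set_def signed_permutation_def)
qed

text \<open>Lebesgue measure is determined by its values on boxes, and the preimage of a box is a
  box with the same side lengths in permuted order.\<close>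

lemma lborel_distr_signed_permutation:
  fixes p :: "'n::finite \<Rightarrow> 'n"
  assumes p: "bij p" and s: "\<And>k. \<bar>s k\<bar> = 1"
  shows "distr lborel borel (signed_permutation s p) = lborel"
proof (rule lborel_eqI[symmetric])
  have meas: "signed_permutation s p \<in> borel_measurable borel"
    unfolding signed_permutation_def by (intro borel_measurable_continuous_onI continuous_intros)
  fix l u :: "real^'n"
  assume "\<And>b. b \<in> Basis \<Longrightarrow> l \<bullet> b \<le> u \<bullet> b"
  then have lu: "l $ i \<le> u $ i" for i by (force simp: Basis_vec_def inner_axis)
  have s': "s k = 1 \<or> s k = -1" for k using s[of k] by linarith
  define q where "q = inv p"
  have pq [simp]: "p (q i) = i" "q (p i) = i" for i
    using p by (auto simp: q_def bij_is_inj bij_is_surj surj_f_inv_f)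
  \<comment> \<open>Coordinate \<open>i\<close> of the preimage is governed by the bounds at
    \<open>q i\<close>; a negative sign exchanges and negates them.\<close>
  define l' u' :: "real^'n" where "l' = (\<chi> i. if s (q i) = 1 then l $ q i else - u $ q i)"
    and "u' = (\<chi> i. if s (q i) = 1 then u $ q i else - l $ q i)"
  have "(\<forall>k. l $ k < s k * x $ p k \<and> s k * x $ p k < u $ k)
      \<longleftrightarrow> (\<forall>i. l' $ i < x $ i \<and> x $ i < u' $ i)" (is "?L \<longleftrightarrow> ?R") for x
  proof -
    have "?R \<longleftrightarrow> (\<forall>k. l' $ p k < x $ p k \<and> x $ p k < u' $ p k)" by (metis pq(1))
    moreover have "(l $ k < s k * x $ p k \<and> s k * x $ p k < u $ k)
        \<longleftrightarrow> (l' $ p k < x $ p k \<and> x $ p k < u' $ p k)" for k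
      using s'[of k] by (auto simp: l'_def u'_def)
    ultimately show ?thesis by simp
  qed
  then have "signed_permutation s p -` box l u = box l' u'"
    by (auto simp: box_vec_eq signed_permutation_def)
  then have "emeasure (distr lborel borel (signed_permutation s p)) (box l u) = emeasure lborel (box l' u')"
    using meas by (simp add: emeasure_distr)
  also have "\<dots> = ennreal (\<Prod>i\<in>UNIV. u' $ i - l' $ i)"
    using lu by (intro emeasure_lborel_box_vec) (auto simp: l'_def u'_def)
  also have "(\<Prod>i\<in>UNIV. u' $ i - l' $ i) = (\<Prod>i\<in>UNIV. u $ q i - l $ q i)"
    by (intro prod.cong) (auto simp: l'_def u'_def)
  also have "\<dots> = (\<Prod>i\<in>UNIV. u $ i - l $ i)"
    using p by (intro prod.reindex_bij_betw) (simp add: q_def bij_imp_bij_inv)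
  also have "ennreal \<dots> = emeasure lborel (box l u)"
    using lu by (simp add: emeasure_lborel_box_vec)
  also have "\<dots> = (\<Prod>b\<in>Basis. (u - l) \<bullet> b)"
    using lu by (subst emeasure_lborel_box) (auto simp: Basis_vec_def inner_axis)
  finally show "emeasure (distr lborel borel (signed_permutation s p)) (box l u) = (\<Prod>b\<in>Basis. (u - l) \<bullet> b)" .
qed simp

section \<open>Integrals over balls and their symmetries\<close>

lemma set_integrable_cball:
  fixes f :: "real^'n \<Rightarrow> real"
  assumes "continuous_on UNIV f"
  shows "set_integrable lborel (cball a r) f"
  unfolding set_integrable_def using assms
  by (intro borel_integrable_compact) (auto intro: continuous_on_subset)

lemma set_lebesgue_integral_sum:
  fixes f :: "'i \<Rightarrow> 'a \<Rightarrow> real"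
  assumes "\<And>i. i \<in> I \<Longrightarrow> set_integrable M S (f i)"
  shows "(LINT x:S|M. (\<Sum>i\<in>I. f i x)) = (\<Sum>i\<in>I. LINT x:S|M. f i x)"
  using assms unfolding set_integrable_def set_lebesgue_integral_def
  by (simp add: scaleR_sum_right del: real_scaleR_def)

text \<open>Change of variables: the map preserves Lebesgue measure and the norm, hence the
  ball.\<close>

lemma cball_integral_signed_permutation:
  fixes f :: "real^'n \<Rightarrow> real"
  assumes p: "bij p" and s: "\<And>k. \<bar>s k\<bar> = 1" and f: "continuous_on UNIV f"
  shows "(LINT y:cball 0 r|lborel. f (signed_permutation s p y)) = (LINT y:cball 0 r|lborel. f y)"
proof -
  have [measurable]: "signed_permutation s p \<in> borel_measurable borel"
    unfolding signed_permutation_def by (intro borel_measurable_continuous_onI continuous_intros)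
  have [measurable]: "f \<in> borel_measurable borel" using f by (rule borel_measurable_continuous_onI)
  have "(LINT y:cball 0 r|lborel. f y)
      = (LINT y|distr lborel borel (signed_permutation s p). indicator (cball 0 r) y *\<^sub>R f y)"
    by (simp add: lborel_distr_signed_permutation[OF p s] set_lebesgue_integral_def)
  also have "\<dots> = (LINT y|lborel. indicator (cball 0 r) (signed_permutation s p y) *\<^sub>R f (signed_permutation s p y))"
    by (rule integral_distr) (auto intro!: borel_measurable_times borel_measurable_indicator)
  also have "\<dots> = (LINT y:cball 0 r|lborel. f (signed_permutation s p y))"
    by (simp add: set_lebesgue_integral_def indicator_def norm_signed_permutation[OF p s])
  finally show ?thesis by simp
qed

text \<open>Reflection at the origin turns the integral into its own negative.\<close>

lemma cball_integral_linear:
  fixes c :: "real^'n"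
  shows "(LINT y:cball 0 r|lborel. c \<bullet> y) = 0"
proof -
  have "(LINT y:cball 0 r|lborel. c \<bullet> signed_permutation (\<lambda>_. - 1) id y) = (LINT y:cball 0 r|lborel. c \<bullet> y)"
    by (intro cball_integral_signed_permutation continuous_intros) (auto simp: bij_id[unfolded id_def] id_def)
  moreover have "signed_permutation (\<lambda>_. - 1) id y = - y" for y :: "real^'n"
    by (simp add: signed_permutation_def vec_eq_iff)
  ultimately show ?thesis by (simp add: set_lebesgue_integral_def)
qed

text \<open>Changing the sign of coordinate \<open>i\<close> alone negates the integrand but
  preserves the integral.\<close>

lemma cball_integral_offdiagonal:
  fixes i j :: "'n::finite"
  assumes "i \<noteq> j"
  shows "(LINT y:cball 0 r|lborel. (y::real^'n) $ i * y $ j) = 0"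
proof -
  let ?s = "\<lambda>k. if k = i then - 1 else 1 :: real"
  have "(LINT y:cball 0 r|lborel. signed_permutation ?s id (y::real^'n) $ i * signed_permutation ?s id y $ j)
      = (LINT y:cball 0 r|lborel. (y::real^'n) $ i * y $ j)"
    by (rule cball_integral_signed_permutation) (auto simp: bij_id[unfolded id_def] id_def intro!: continuous_intros)
  then show ?thesis using assms by (simp add: signed_permutation_def set_lebesgue_integral_def)
qed

lemma cball_integral_diagonal_eq:
  fixes i j :: "'n::finite"
  shows "(LINT y:cball 0 r|lborel. ((y::real^'n) $ i)\<^sup>2) = (LINT y:cball 0 r|lborel. ((y::real^'n) $ j)\<^sup>2)"
proof -
  \<comment> \<open>The transposition of \<open>i\<close> and \<open>j\<close>, which is its own
    inverse.\<close>
  let ?p = "\<lambda>k. if k = i then j else if k = j then i else k"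
  have "bij ?p" by (rule o_bij[of ?p]) auto
  then have "(LINT y:cball 0 r|lborel. (signed_permutation (\<lambda>_. 1) ?p (y::real^'n) $ i)\<^sup>2)
      = (LINT y:cball 0 r|lborel. ((y::real^'n) $ i)\<^sup>2)"
    by (intro cball_integral_signed_permutation[where f = "\<lambda>y. (y $ i)\<^sup>2"]) (auto intro!: continuous_intros)
  then show ?thesis by (simp add: signed_permutation_def)
qed

section \<open>The integral of the squared norm over a ball\<close>

lemma cball_integral_norm_sq_scale:
  assumes "r > 0"
  shows "(LINT y:cball 0 r|lborel. (norm (y::real^'n))\<^sup>2)
     = r ^ (CARD('n) + 2) * (LINT y:cball 0 1|lborel. (norm (y::real^'n))\<^sup>2)"
proof -
  \<comment> \<open>\<open>T\<close> is multiplication by \<open>r\<close>, written coordinatewise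
    to match \<open>lborel_affine_euclidean\<close>. The Jacobian yields
    \<open>r ^ CARD('n)\<close>, the squared norm of \<open>T y\<close> the two further factors
    \<open>r\<close>.\<close>
  define T :: "real^'n \<Rightarrow> real^'n" where "T x = 0 + (\<Sum>j\<in>Basis. (r * (x \<bullet> j)) *\<^sub>R j)" for x
  have T: "T x = r *\<^sub>R x" for x
    by (simp add: T_def euclidean_representation flip: scaleR_scaleR scaleR_sum_right)
  have [measurable]: "T \<in> borel_measurable borel" unfolding T by measurable
  have "lborel = density (distr lborel borel T) (\<lambda>_. (\<Prod>j\<in>(Basis::(real^'n) set). \<bar>r\<bar>))"
    unfolding T_def using assms by (intro lborel_affine_euclidean) auto
  then have "lborel = density (distr lborel borel T) (\<lambda>_. ennreal (r ^ CARD('n)))"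
    using assms by simp
  then have "(LINT y:cball 0 r|lborel. (norm (y::real^'n))\<^sup>2)
      = (LINT y|density (distr lborel borel T) (\<lambda>_. ennreal (r ^ CARD('n))). indicator (cball 0 r) y *\<^sub>R (norm y)\<^sup>2)"
    unfolding set_lebesgue_integral_def by (rule arg_cong)
  also have "\<dots> = (LINT y|distr lborel borel T. r ^ CARD('n) *\<^sub>R (indicator (cball 0 r) y *\<^sub>R (norm y)\<^sup>2))"
    using assms by (intro integral_density) (auto intro!: borel_measurable_times borel_measurable_indicator)
  also have "\<dots> = (LINT y|lborel. r ^ CARD('n) *\<^sub>R (indicator (cball 0 r) (T y) *\<^sub>R (norm (T y))\<^sup>2))"
    by (rule integral_distr) (auto intro!: borel_measurable_times borel_measurable_indicator)
  also have "\<dots> = (LINT y|lborel. r ^ (CARD('n) + 2) * (indicator (cball 0 1) y *\<^sub>R (norm (y::real^'n))\<^sup>2))"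
    using assms by (intro Bochner_Integration.integral_cong)
      (auto simp: T indicator_def power_mult_distrib power_add power2_eq_square mult_le_cancel_left1)
  finally show ?thesis by (simp add: set_lebesgue_integral_def)
qed

lemma measure_cball_scale:
  assumes "r \<ge> 0"
  shows "measure lborel (cball (0::real^'n) r) = r ^ CARD('n) * measure lborel (cball (0::real^'n) 1)"
  unfolding content_cball[OF assms] content_cball[OF zero_le_one] by simp

text \<open>By homogeneity the unit ball integral \<open>F\<close> of the squared norm is determined by its thin shells:
  on the shell between the radii \<open>r\<close> and \<open>1\<close> the integrand lies between \<open>r\<^sup>2\<close> and \<open>1\<close>. The bounds
  are stated after division by \<open>1 - r\<close>, so that one can let \<open>r\<close> tend to \<open>1\<close>.\<close>

lemma cball_shell_integral_norm_sq:
  fixes n :: nat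
  defines "n \<equiv> CARD('n)"
  defines "F \<equiv> (LINT y:cball 0 1|lborel. (norm (y::real^'n))\<^sup>2)"
    and "w \<equiv> measure lborel (cball (0::real^'n) 1)"
  assumes r: "0 < r" "r < 1"
  shows "F * (\<Sum>k<n + 2. r ^ k) \<le> w * (\<Sum>k<n. r ^ k)"
    and "r\<^sup>2 * (w * (\<Sum>k<n. r ^ k)) \<le> F * (\<Sum>k<n + 2. r ^ k)"
proof -
  let ?D = "cball (0::real^'n) 1 - cball 0 r"
  have sub: "cball 0 r \<subseteq> cball (0::real^'n) 1" using r by auto
  have int: "set_integrable lborel S (\<lambda>y. (norm (y::real^'n))\<^sup>2)" if "S \<subseteq> cball 0 1" "S \<in> sets lborel" for S
    by (rule set_integrable_subset[OF set_integrable_cball that(2,1)]) (intro continuous_intros)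
  have fin: "emeasure lborel S < \<infinity>" if "S \<subseteq> cball (0::real^'n) 1" for S
    using emeasure_mono[OF that, of lborel] emeasure_lborel_cball_finite[of "0::real^'n" 1]
    by (auto intro: le_less_trans)
  have mD: "measure lborel ?D = w * (1 - r ^ n)"
    using measure_cball_scale[of r, where 'n='n] r sub fin[of "cball 0 r"] fin[of "cball 0 1"]
    by (subst measure_Diff) (auto simp: w_def n_def algebra_simps)
  have "F = (LINT y:?D \<union> cball 0 r|lborel. (norm y)\<^sup>2)" using sub by (simp add: F_def Un_absorb2)
  also have "\<dots> = (LINT y:?D|lborel. (norm y)\<^sup>2) + (LINT y:cball 0 r|lborel. (norm (y::real^'n))\<^sup>2)"
    by (rule set_integral_Un) (use sub in \<open>auto intro!: int\<close>)
  \<comment> \<open>By scaling, the inner ball carries the part \<open>r ^ (n + 2) * F\<close> of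
    the integral.\<close>
  finally have FD: "(LINT y:?D|lborel. (norm y)\<^sup>2) = F * (1 - r ^ (n + 2))"
    using cball_integral_norm_sq_scale[OF r(1), where 'n='n] by (simp add: F_def n_def algebra_simps)
  have const: "set_integrable lborel ?D (\<lambda>_. c)" "(LINT y:?D|lborel. c) = measure lborel ?D * c" for c :: real
    using fin[of ?D] by (auto simp: set_integrable_def set_lebesgue_integral_def)
  have le1: "(norm y)\<^sup>2 \<le> 1" if "y \<in> ?D" for y using that by (simp add: power_le_one)
  have le2: "r\<^sup>2 \<le> (norm y)\<^sup>2" if "y \<in> ?D" for y using that r by (intro power_mono) auto
  have "(LINT y:?D|lborel. (norm y)\<^sup>2) \<le> (LINT y:?D|lborel. 1)"
    by (intro set_integral_mono int const le1) auto
  then have up: "F * (1 - r ^ (n + 2)) \<le> w * (1 - r ^ n)" by (simp only: FD const mD mult_1_right)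
  have "(LINT y:?D|lborel. r\<^sup>2) \<le> (LINT y:?D|lborel. (norm y)\<^sup>2)"
    by (intro set_integral_mono int const le2) auto
  then have lo: "r\<^sup>2 * (w * (1 - r ^ n)) \<le> F * (1 - r ^ (n + 2))"
    by (simp only: FD const mD mult.commute)
  \<comment> \<open>Cancelling the common factor \<open>1 - r\<close> leaves geometric sums with
    \<open>n + 2\<close> and \<open>n\<close> terms; these counts become the ratio
    \<open>n / (n + 2)\<close> as \<open>r\<close> tends to \<open>1\<close>.\<close>
  have geo: "1 - r ^ m = (1 - r) * (\<Sum>k<m. r ^ k)" for m by (rule one_diff_power_eq)
  have "(1 - r) * (F * (\<Sum>k<n + 2. r ^ k)) \<le> (1 - r) * (w * (\<Sum>k<n. r ^ k))"
    using up by (simp only: geo mult_ac)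
  then show "F * (\<Sum>k<n + 2. r ^ k) \<le> w * (\<Sum>k<n. r ^ k)" using r by simp
  have "(1 - r) * (r\<^sup>2 * (w * (\<Sum>k<n. r ^ k))) \<le> (1 - r) * (F * (\<Sum>k<n + 2. r ^ k))"
    using lo by (simp only: geo mult_ac)
  then show "r\<^sup>2 * (w * (\<Sum>k<n. r ^ k)) \<le> F * (\<Sum>k<n + 2. r ^ k)" using r by simp
qed

text \<open>As \<open>r\<close> tends to \<open>1\<close> from the left, each geometric sum tends to
  its number of terms and \<open>r\<^sup>2\<close> to \<open>1\<close>, so the two shell bounds
  merge into an equality.\<close>

lemma unit_cball_integral_norm_sq:
  "(real CARD('n) + 2) * (LINT y:cball 0 1|lborel. (norm (y::real^'n))\<^sup>2)
     = real CARD('n) * measure lborel (cball (0::real^'n) 1)"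
proof -
  define F w where "F = (LINT y:cball 0 1|lborel. (norm (y::real^'n))\<^sup>2)"
    and "w = measure lborel (cball (0::real^'n) 1)"
  let ?f = "\<lambda>r. F * (\<Sum>k<CARD('n) + 2. r ^ k)" and ?g = "\<lambda>r. w * (\<Sum>k<CARD('n). r ^ k)"
  have f: "(?f \<longlongrightarrow> F * (\<Sum>k<CARD('n) + 2. 1 ^ k)) (at_left 1)"
    and g: "(?g \<longlongrightarrow> w * (\<Sum>k<CARD('n). 1 ^ k)) (at_left 1)"
    and g2: "((\<lambda>r. r\<^sup>2 * ?g r) \<longlongrightarrow> 1\<^sup>2 * (w * (\<Sum>k<CARD('n). 1 ^ k))) (at_left 1)"
    by (intro tendsto_intros)+
  have ev: "\<forall>\<^sub>F r in at_left 1. (0::real) < r \<and> r < 1"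
    by (simp add: eventually_at_left_field) (use zero_less_one in blast)
  have "\<forall>\<^sub>F r in at_left 1. ?f r \<le> ?g r"
    using ev unfolding F_def w_def by (rule eventually_mono) (rule cball_shell_integral_norm_sq(1); simp)
  then have "F * (\<Sum>k<CARD('n) + 2. 1 ^ k) \<le> w * (\<Sum>k<CARD('n). 1 ^ k)"
    by (rule tendsto_le[OF trivial_limit_at_left_real g f])
  moreover have "\<forall>\<^sub>F r in at_left 1. r\<^sup>2 * ?g r \<le> ?f r"
    using ev unfolding F_def w_def by (rule eventually_mono) (rule cball_shell_integral_norm_sq(2); simp)
  then have "1\<^sup>2 * (w * (\<Sum>k<CARD('n). 1 ^ k)) \<le> F * (\<Sum>k<CARD('n) + 2. 1 ^ k)"
    by (rule tendsto_le[OF trivial_limit_at_left_real f g2])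
  ultimately show ?thesis by (simp add: F_def w_def algebra_simps)
qed

lemma cball_integral_norm_sq:
  assumes "r > 0"
  shows "(LINT y:cball 0 r|lborel. (norm (y::real^'n))\<^sup>2)
     = real CARD('n) / (real CARD('n) + 2) * r\<^sup>2 * measure lborel (cball (0::real^'n) r)"
proof -
  have pos: "real CARD('n) + 2 > 0" by simp
  have "(LINT y:cball 0 1|lborel. (norm (y::real^'n))\<^sup>2)
      = real CARD('n) * measure lborel (cball (0::real^'n) 1) / (real CARD('n) + 2)"
    using unit_cball_integral_norm_sq[where 'n='n] pos
    by (intro eq_divide_imp) (simp_all only: mult.commute)
  then show ?thesis
    using assms unfolding cball_integral_norm_sq_scale[OF assms] measure_cball_scale[OF less_imp_le[OF assms]]
    by (simp add: power_add power2_eq_square)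
qed

text \<open>The diagonal moments are equal and add up to the integral of the squared norm, so each
  is its \<open>CARD('n)\<close>-th part.\<close>

lemma cball_integral_second_moment:
  fixes i j :: "'n::finite"
  assumes "r > 0"
  shows "(LINT y:cball 0 r|lborel. (y::real^'n) $ i * y $ j)
     = (if i = j then r\<^sup>2 / (real CARD('n) + 2) * measure lborel (cball (0::real^'n) r) else 0)"
proof -
  have "(LINT y:cball 0 r|lborel. (norm (y::real^'n))\<^sup>2) = (\<Sum>k\<in>UNIV. LINT y:cball 0 r|lborel. ((y::real^'n) $ k)\<^sup>2)"
  proof -
    have "(LINT y:cball 0 r|lborel. (norm (y::real^'n))\<^sup>2) = (LINT y:cball 0 r|lborel. (\<Sum>k\<in>UNIV. ((y::real^'n) $ k)\<^sup>2))"
      by (simp add: norm_vec_def L2_set_def sum_nonneg)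
    also have "\<dots> = (\<Sum>k\<in>UNIV. LINT y:cball 0 r|lborel. ((y::real^'n) $ k)\<^sup>2)"
      by (rule set_lebesgue_integral_sum) (intro set_integrable_cball continuous_intros)
    finally show ?thesis .
  qed
  also have "\<dots> = (\<Sum>k\<in>(UNIV::'n set). LINT y:cball 0 r|lborel. ((y::real^'n) $ i)\<^sup>2)"
    by (intro sum.cong cball_integral_diagonal_eq refl)
  finally have "real CARD('n) * (LINT y:cball 0 r|lborel. ((y::real^'n) $ i)\<^sup>2)
      = real CARD('n) * (r\<^sup>2 / (real CARD('n) + 2) * measure lborel (cball (0::real^'n) r))"
    unfolding cball_integral_norm_sq[OF assms] by simp
  then have "(LINT y:cball 0 r|lborel. ((y::real^'n) $ i)\<^sup>2)
      = r\<^sup>2 / (real CARD('n) + 2) * measure lborel (cball (0::real^'n) r)"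
    by (rule mult_left_cancel[THEN iffD1, rotated]) simp
  then show ?thesis using cball_integral_offdiagonal[of i j r] by (auto simp: power2_eq_square)
qed

text \<open>The linear term and the mixed products integrate to zero; the equal diagonal moments
  collect the diagonal of \<open>K\<close> into its trace.\<close>

lemma cball_integral_quadratic:
  fixes K :: "real^'n^'n"
  assumes "r > 0"
  shows "(LINT y:cball 0 r|lborel. a + c \<bullet> y + y \<bullet> (K *v y))
     = (a + r\<^sup>2 / (real CARD('n) + 2) * trace K) * measure lborel (cball (0::real^'n) r)"
proof -
  have a: "set_integrable lborel (cball 0 r) (\<lambda>y::real^'n. a)"
    and c: "set_integrable lborel (cball 0 r) (\<lambda>y::real^'n. c \<bullet> y)"
    and K: "set_integrable lborel (cball 0 r) (\<lambda>y::real^'n. y \<bullet> (K *v y))"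
    and ij: "set_integrable lborel (cball 0 r) (\<lambda>y::real^'n. K $ i $ j * (y $ i * y $ j))"
    and isum: "set_integrable lborel (cball 0 r) (\<lambda>y::real^'n. \<Sum>j\<in>UNIV. K $ i $ j * (y $ i * y $ j))" for i j
    by (intro set_integrable_cball continuous_intros matrix_vector_mult_linear_continuous_on)+
  have "(LINT y:cball 0 r|lborel. y \<bullet> (K *v y))
      = (LINT y:cball 0 r|lborel. (\<Sum>i\<in>UNIV. \<Sum>j\<in>UNIV. K $ i $ j * (y $ i * y $ j)))"
    by (simp add: inner_vec_def matrix_vector_mult_def sum_distrib_left mult_ac)
  also have "\<dots> = (\<Sum>i\<in>UNIV. \<Sum>j\<in>UNIV. LINT y:cball 0 r|lborel. K $ i $ j * (y $ i * y $ j))"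
    by (simp only: set_lebesgue_integral_sum[OF isum] set_lebesgue_integral_sum[OF ij])
  also have "\<dots> = (\<Sum>i\<in>UNIV. \<Sum>j\<in>UNIV. K $ i $ j *
      (if i = j then r\<^sup>2 / (real CARD('n) + 2) * measure lborel (cball (0::real^'n) r) else 0))"
    by (simp only: set_integral_mult_right cball_integral_second_moment[OF assms])
  also have "\<dots> = r\<^sup>2 / (real CARD('n) + 2) * measure lborel (cball (0::real^'n) r) * trace K"
    by (simp add: trace_def sum_distrib_left sum_divide_distrib mult_ac if_distrib[of "\<lambda>a. _ * a"] cong: if_cong)
  finally have quad: "(LINT y:cball 0 r|lborel. y \<bullet> (K *v y))
      = r\<^sup>2 / (real CARD('n) + 2) * measure lborel (cball (0::real^'n) r) * trace K" .
  have const: "(LINT y:cball (0::real^'n) r|lborel. a) = measure lborel (cball (0::real^'n) r) * a"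
    using emeasure_lborel_cball_finite[of "0::real^'n" r] by (simp add: set_lebesgue_integral_def)
  have "(LINT y:cball 0 r|lborel. a + c \<bullet> y + y \<bullet> (K *v y))
      = (LINT y:cball (0::real^'n) r|lborel. a) + (LINT y:cball 0 r|lborel. c \<bullet> y)
        + (LINT y:cball 0 r|lborel. y \<bullet> (K *v y))"
    by (simp only: set_integral_add(2)[OF set_integral_add(1)[OF a c] K] set_integral_add(2)[OF a c])
  then show ?thesis
    by (simp add: cball_integral_linear quad const algebra_simps)
qed

section \<open>Averages of paraboloids\<close>

lemma inner_matrix_vector_transpose:
  fixes M :: "real^'n^'n"
  shows "x \<bullet> (M *v y) = (transpose M *v x) \<bullet> y"
  by (simp add: dot_lmul_matrix)

lemma partial_deriv_eqI:
  assumes "(g has_derivative g') (at x)"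
  shows "partial_deriv i g x = g' (axis i 1)"
  using frechet_derivative_at[OF assms] by (simp add: partial_deriv_def)

text \<open>The gradient at \<open>x\<close> is \<open>b + (M + transpose M) *v x\<close>;
  differentiating this affine map gives its matrix.\<close>

lemma hessian_quadratic:
  fixes M :: "real^'n^'n"
  shows "hessian (\<lambda>y. c + b \<bullet> y + y \<bullet> (M *v y)) x = M + transpose M"
proof -
  let ?P = "\<lambda>y. c + b \<bullet> y + y \<bullet> (M *v y)"
  have M: "((\<lambda>x. M *v x) has_derivative (\<lambda>h. M *v h)) (at x)" for x and M :: "real^'n^'n"
    by (simp add: bounded_linear_imp_has_derivative)
  have 1: "partial_deriv j ?P = (\<lambda>x. b $ j + ((M + transpose M) *v x) $ j)" for j
  proof
    fix x
    have "(?P has_derivative (\<lambda>h. b \<bullet> h + (x \<bullet> (M *v h) + h \<bullet> (M *v x)))) (at x)"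
      by (auto intro!: derivative_eq_intros M)
    then have "partial_deriv j ?P x = b \<bullet> axis j 1 + (x \<bullet> (M *v axis j 1) + axis j 1 \<bullet> (M *v x))"
      by (rule partial_deriv_eqI)
    then show "partial_deriv j ?P x = b $ j + ((M + transpose M) *v x) $ j"
      by (simp add: inner_matrix_vector_transpose[of x] inner_axis inner_axis' matrix_vector_mult_add_rdistrib
          del: transpose_matrix_vector)
  qed
  have "partial_deriv i (partial_deriv j ?P) x = (M + transpose M) $ i $ j" for i j
  proof -
    have "((\<lambda>x. b $ j + ((M + transpose M) *v x) $ j) has_derivative
        (\<lambda>h. ((M + transpose M) *v h) $ j)) (at x)"
      by (auto intro!: derivative_eq_intros M bounded_linear.has_derivative[OF bounded_linear_vec_nth])
    then have "partial_deriv i (partial_deriv j ?P) x = ((M + transpose M) *v axis i 1) $ j"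
      unfolding 1 by (rule partial_deriv_eqI)
    then show ?thesis by (simp only: matrix_vector_mult_basis) (simp add: column_def transpose_def)
  qed
  then show ?thesis by (simp add: hessian_def vec_eq_iff)
qed

text \<open>Midpoint convexity between \<open>v\<close> and \<open>- v\<close>: constants and linear
  terms cancel, leaving \<open>0 \<le> v \<bullet> (M *v v)\<close>.\<close>

lemma convex_quadratic_pos_semidef:
  fixes M :: "real^'n^'n"
  assumes "convex_on UNIV (\<lambda>y. c + b \<bullet> y + y \<bullet> (M *v y))"
  shows "pos_semidef (M + transpose M)"
proof -
  have "0 \<le> v \<bullet> (M *v v)" for v
  proof -
    have "0 = (1/2) *\<^sub>R v + (1 - 1/2) *\<^sub>R (- v)" by simp
    then show ?thesis
      using convex_onD[OF assms, of "1/2" "- v" v] linear_neg[OF matrix_vector_mul_linear, of M v] by (simp add: algebra_simps)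
  qed
  moreover have "v \<bullet> (transpose M *v v) = v \<bullet> (M *v v)" for v
    using inner_matrix_vector_transpose[of v M v] by (simp add: inner_commute)
  ultimately show ?thesis
    by (simp add: pos_semidef_def transpose_def vec_eq_iff matrix_vector_mult_add_rdistrib inner_add_right
        del: transpose_matrix_vector)
qed

lemma convex_paraboloid_pos_semidef_hessian:
  assumes "convex_paraboloid P"
  shows "pos_semidef (hessian P x)"
proof -
  obtain c b M where "\<And>y. P y = c + b \<bullet> y + y \<bullet> (M *v y)"
    using assms by (auto simp: convex_paraboloid_def paraboloid_def)
  then have P: "P = (\<lambda>y. c + b \<bullet> y + y \<bullet> (M *v y))" by auto
  show ?thesis
    using assms convex_quadratic_pos_semidef by (auto simp: P hessian_quadratic convex_paraboloid_def)
qed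

lemma matrix_add_rdistrib:
  fixes A :: "real^'n^'m"
  shows "(A + B) ** C = A ** C + B ** C"
  by (simp add: matrix_matrix_mult_def vec_eq_iff sum.distrib ring_distribs)

lemma trace_transpose: "trace (transpose A) = trace A"
  by (simp add: trace_def transpose_def)

lemma ball_average_paraboloid:
  fixes A :: "real^'n^'n"
  assumes "paraboloid P" and A: "transpose A = A" and "\<epsilon> > 0"
  shows "ball_average P x A \<epsilon> = P x + \<epsilon>\<^sup>2 / (2 * (real CARD('n) + 2)) * trace (A ** hessian P x ** A)"
proof -
  obtain c b M where "\<And>y. P y = c + b \<bullet> y + y \<bullet> (M *v y)"
    using assms by (auto simp: paraboloid_def)
  then have P: "P = (\<lambda>y. c + b \<bullet> y + y \<bullet> (M *v y))" by auto
  \<comment> \<open>Taylor expansion of \<open>P\<close> at \<open>x\<close> in the variable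
    \<open>A *v y\<close>: by symmetry of \<open>A\<close>, \<open>?g\<close> is \<open>A\<close>
    applied to the gradient and \<open>?K\<close> is the pulled back quadratic part.\<close>
  let ?K = "A ** M ** A" and ?g = "A *v (b + (M + transpose M) *v x)"
  have "P (x + A *v y) = P x + ?g \<bullet> y + y \<bullet> (?K *v y)" for y
  proof -
    have "P (x + A *v y) = P x + (b + (M + transpose M) *v x) \<bullet> (A *v y) + (A *v y) \<bullet> (M *v (A *v y))"
      using inner_matrix_vector_transpose[of x M "A *v y"]
      by (simp add: P matrix_vector_right_distrib matrix_vector_mult_add_rdistrib inner_add_left inner_add_right
          inner_commute[of "M *v x"] del: transpose_matrix_vector)
    also have "(A *v y) \<bullet> (M *v (A *v y)) = y \<bullet> (?K *v y)"
      using symmetric_inner_matrix_vector[OF A, of y "M *v (A *v y)"]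
      by (simp only: matrix_vector_mul_assoc matrix_mul_assoc)
    finally show ?thesis by (simp only: symmetric_inner_matrix_vector[OF A])
  qed
  then have "ball_average P x A \<epsilon> = P x + \<epsilon>\<^sup>2 / (real CARD('n) + 2) * trace ?K"
    using assms(3) by (simp add: ball_average_def cball_integral_quadratic)
  \<comment> \<open>The Hessian is \<open>M + transpose M\<close>, and transposing keeps the trace;
    hence the \<open>2\<close> in the denominator.\<close>
  moreover have "trace (A ** hessian P x ** A) = 2 * trace ?K"
  proof -
    have "A ** transpose M ** A = transpose ?K"
      by (simp add: matrix_transpose_mul A matrix_mul_assoc)
    then show ?thesis
      by (simp add: P hessian_quadratic matrix_add_ldistrib matrix_add_rdistrib trace_add trace_transpose)
  qed
  ultimately show ?thesis by (simp add: field_simps)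
qed

section \<open>The limit of the mean value quotient and its sign\<close>

lemma tendsto_mean_value_quotient:
  fixes P :: "real^'n \<Rightarrow> real"
  assumes P: "convex_paraboloid P" and \<phi>: "filterlim \<phi> at_top (at_right 0)"
  shows "((\<lambda>\<epsilon>. (P x - mean_value \<phi> f P x \<epsilon>) / \<epsilon>\<^sup>2) \<longlongrightarrow>
     real CARD('n) / (2 * (real CARD('n) + 2)) * (root CARD('n) (f x) - root CARD('n) (det (hessian P x)))) (at_right 0)"
proof -
  define H where "H = hessian P x"
  define N where "N = 2 * (real CARD('n) + 2)"
  \<comment> \<open>\<open>L\<close> is the infimum of the trace over all positive definite matrices
    of determinant \<open>1\<close>, so \<open>L / N\<close> is the expected limit of
    \<open>(m \<epsilon> - P x) / \<epsilon>\<^sup>2\<close>.\<close>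
  define L where "L = real CARD('n) * root CARD('n) (det H)"
  define m where "m \<epsilon> = (INF A\<in>admissible (\<phi> \<epsilon>). ball_average P x A \<epsilon>)" for \<epsilon>
  have H: "pos_semidef H" unfolding H_def by (rule convex_paraboloid_pos_semidef_hessian[OF P])
  have N: "N > 0" by (simp add: N_def add_pos_nonneg)
  have avg: "ball_average P x A \<epsilon> = P x + \<epsilon>\<^sup>2 / N * trace (A ** H ** A)"
    if "A \<in> admissible t" "\<epsilon> > 0" for A t \<epsilon>
    unfolding H_def N_def using P that
    by (intro ball_average_paraboloid) (auto simp: convex_paraboloid_def admissible_def pos_def_def)
  have lower: "P x + \<epsilon>\<^sup>2 / N * L \<le> ball_average P x A \<epsilon>" if "A \<in> admissible t" "\<epsilon> > 0" for A t \<epsilon>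
    using admissible_trace_lower_bound[OF H that(1)] N
    by (simp add: avg[OF that] L_def mult_left_mono divide_right_mono)
  have close: "\<forall>\<^sub>F \<epsilon> in at_right 0. \<bar>(m \<epsilon> - P x) / \<epsilon>\<^sup>2 - L / N\<bar> < \<delta>" if "\<delta> > 0" for \<delta>
  proof -
    \<comment> \<open>A competitor fixed before \<open>\<epsilon>\<close>; its slack
      \<open>N * \<delta>\<close> becomes \<open>\<delta>\<close> after division by
      \<open>N\<close>.\<close>
    obtain A :: "real^'n^'n" where A: "pos_def A" "det A = 1" "trace (A ** H ** A) < L + N * \<delta>"
      using admissible_trace_upper_bound[OF H, of "N * \<delta>"] N \<open>\<delta> > 0\<close> unfolding L_def by auto
    have "\<forall>\<^sub>F \<epsilon> in at_right 0. A \<in> admissible (\<phi> \<epsilon>)"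
      using \<phi> eventually_admissible[OF A(1,2)] by (auto simp: filterlim_iff)
    then show ?thesis
      using eventually_at_right_less[of 0]
    proof eventually_elim
      case (elim \<epsilon>)
      \<comment> \<open>The infimum is a genuine one: \<open>A\<close> makes the index set nonempty,
        and \<open>lower\<close> bounds the averages from below.\<close>
      have "P x + \<epsilon>\<^sup>2 / N * L \<le> m \<epsilon>"
        unfolding m_def using elim by (intro cINF_greatest lower) auto
      moreover have "m \<epsilon> \<le> P x + \<epsilon>\<^sup>2 / N * trace (A ** H ** A)"
        unfolding m_def avg[OF elim, symmetric] using elim
        by (intro cINF_lower bdd_belowI2[of _ "P x + \<epsilon>\<^sup>2 / N * L"] lower) auto
      moreover have "\<epsilon>\<^sup>2 / N * trace (A ** H ** A) < \<epsilon>\<^sup>2 / N * (L + N * \<delta>)"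
        using A(3) N elim by (intro mult_strict_left_mono) auto
      ultimately have "\<epsilon>\<^sup>2 * (L / N) \<le> m \<epsilon> - P x" "m \<epsilon> - P x < \<epsilon>\<^sup>2 * (L / N + \<delta>)"
        using N by (auto simp: field_simps)
      then have "L / N \<le> (m \<epsilon> - P x) / \<epsilon>\<^sup>2" "(m \<epsilon> - P x) / \<epsilon>\<^sup>2 < L / N + \<delta>"
        using elim by (simp_all add: pos_le_divide_eq pos_divide_less_eq mult.commute)
      then show ?case by simp
    qed
  qed
  then have "((\<lambda>\<epsilon>. (m \<epsilon> - P x) / \<epsilon>\<^sup>2) \<longlongrightarrow> L / N) (at_right 0)"
    by (simp add: tendsto_iff dist_real_def)
  then have "((\<lambda>\<epsilon>. real CARD('n) / N * root CARD('n) (f x) - (m \<epsilon> - P x) / \<epsilon>\<^sup>2) \<longlongrightarrow>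
      real CARD('n) / N * root CARD('n) (f x) - L / N) (at_right 0)"
    by (intro tendsto_diff tendsto_const)
  moreover have "real CARD('n) / N * root CARD('n) (f x) - L / N
      = real CARD('n) / N * (root CARD('n) (f x) - root CARD('n) (det H))"
    by (simp add: L_def right_diff_distrib)
  moreover have "\<forall>\<^sub>F \<epsilon> in at_right 0. real CARD('n) / N * root CARD('n) (f x) - (m \<epsilon> - P x) / \<epsilon>\<^sup>2
      = (P x - mean_value \<phi> f P x \<epsilon>) / \<epsilon>\<^sup>2"
    using eventually_at_right_less[of 0]
    by eventually_elim (simp add: mean_value_def m_def N_def field_simps)
  ultimately show ?thesis
    unfolding N_def H_def by (simp add: tendsto_cong)
qed

text \<open>Positive and negative parts are continuous, so once the quotient converges, uniqueness
  of limits turns both conditions into the sign of \<open>l\<close>.\<close>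

lemma
  assumes "((\<lambda>\<epsilon>. (c - g \<epsilon>) / \<epsilon>\<^sup>2) \<longlongrightarrow> l) (at_right 0)"
  shows le_upto_small_o_sq_iff: "le_upto_small_o_sq c g \<longleftrightarrow> l \<le> 0"
    and ge_upto_small_o_sq_iff: "ge_upto_small_o_sq c g \<longleftrightarrow> l \<ge> 0"
proof -
  \<comment> \<open>This includes \<open>\<epsilon> = 0\<close>, where division by zero makes both
    sides \<open>0\<close>.\<close>
  have max: "max a 0 / \<epsilon>\<^sup>2 = max (a / \<epsilon>\<^sup>2) 0" for a \<epsilon> :: real
    by (auto simp: max_def field_simps divide_le_0_iff)
  have "((\<lambda>\<epsilon>. max ((c - g \<epsilon>) / \<epsilon>\<^sup>2) 0) \<longlongrightarrow> max l 0) (at_right 0)"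
    and "((\<lambda>\<epsilon>. max (- ((c - g \<epsilon>) / \<epsilon>\<^sup>2)) 0) \<longlongrightarrow> max (- l) 0) (at_right 0)"
    using assms by (auto intro!: tendsto_intros)
  then have "le_upto_small_o_sq c g \<longleftrightarrow> max l 0 = 0" "ge_upto_small_o_sq c g \<longleftrightarrow> max (- l) 0 = 0"
    unfolding le_upto_small_o_sq_def ge_upto_small_o_sq_def max
    by (auto simp del: minus_diff_eq simp flip: minus_divide_left dest: tendsto_unique[OF trivial_limit_at_right_real])
  then show "le_upto_small_o_sq c g \<longleftrightarrow> l \<le> 0" "ge_upto_small_o_sq c g \<longleftrightarrow> l \<ge> 0" by auto
qed

text \<open>The limit is \<open>k > 0\<close> times a difference of roots. As \<open>root\<close> is
  strictly increasing, its sign compares \<open>f x\<close> with the determinant.\<close>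

lemma
  fixes P :: "real^'n \<Rightarrow> real"
  assumes "convex_paraboloid P" and "filterlim \<phi> at_top (at_right 0)"
  shows le_upto_mean_value_iff: "le_upto_small_o_sq (P x) (mean_value \<phi> f P x) \<longleftrightarrow> f x \<le> det (hessian P x)"
    and ge_upto_mean_value_iff: "ge_upto_small_o_sq (P x) (mean_value \<phi> f P x) \<longleftrightarrow> det (hessian P x) \<le> f x"
proof -
  define k where "k = real CARD('n) / (2 * (real CARD('n) + 2))"
  have "k > 0" by (simp add: k_def add_pos_nonneg)
  then show "le_upto_small_o_sq (P x) (mean_value \<phi> f P x) \<longleftrightarrow> f x \<le> det (hessian P x)"
    "ge_upto_small_o_sq (P x) (mean_value \<phi> f P x) \<longleftrightarrow> det (hessian P x) \<le> f x"
    unfolding le_upto_small_o_sq_iff[OF tendsto_mean_value_quotient[OF assms]]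
      ge_upto_small_o_sq_iff[OF tendsto_mean_value_quotient[OF assms]] k_def[symmetric]
    by (simp_all add: mult_le_0_iff zero_le_mult_iff)
qed

theorem theorem1p2:
  fixes \<Omega> :: "(real^'n) set"
    and \<phi> :: "real \<Rightarrow> real"
    and f u :: "real^'n \<Rightarrow> real"
  assumes "open \<Omega>" and "convex \<Omega>"
    and "\<And>\<epsilon>. \<epsilon> > 0 \<Longrightarrow> \<phi> \<epsilon> > 0"
    and "filterlim \<phi> at_top (at_right 0)"
    and "((\<lambda>\<epsilon>. \<epsilon> * \<phi> \<epsilon>) \<longlongrightarrow> 0) (at_right 0)"
    and "continuous_on \<Omega> f" and "\<And>x. x \<in> \<Omega> \<Longrightarrow> f x \<ge> 0"
    and "continuous_on \<Omega> u" and "convex_on \<Omega> u"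
  shows "(viscosity_subsolution \<Omega> f u \<longleftrightarrow>
            (\<forall>x\<in>\<Omega>. \<forall>P. convex_paraboloid P \<and> touches_above P u x \<longrightarrow>
               le_upto_small_o_sq (P x) (mean_value \<phi> f P x)))
       \<and> (viscosity_supersolution \<Omega> f u \<longleftrightarrow>
            (\<forall>x\<in>\<Omega>. \<forall>P. convex_paraboloid P \<and> touches_below P u x \<longrightarrow>
               ge_upto_small_o_sq (P x) (mean_value \<phi> f P x)))"
  \<comment> \<open>The conditions agree for each \<open>x\<close> and \<open>P\<close> because
    \<open>\<phi>\<close> tends to infinity, which is \<open>assms(4)\<close>;
    \<open>assms(9)\<close> is the convexity of \<open>u\<close> contained in both notions of
    solution.\<close>
  using le_upto_mean_value_iff[OF _ assms(4)] ge_upto_mean_value_iff[OF _ assms(4)] assms(9)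
  unfolding viscosity_subsolution_def viscosity_supersolution_def by blast

end
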